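(* Let $A,B\in\mathbb{R}^{n\times n}$ be nonzero symmetric matrices with $B$ positive semidefinite, let $\sigma\in\mathbb{R}$ be such that $A-\sigma B$ is nonsingular, and let $C_a,D_a,C_b,X,W,U,\Theta$ be computed quantities and $\tilde U$ an orthogonal matrix satisfying the error bounds (1)–(6) listed in the context. Let $\Theta=\mathrm{diag}(\theta_1,\dots,\theta_r)$ with the computed $\theta_i$ in nondecreasing order, and let $$\eta=\frac{\|A-\sigma B\|_2^{1/2}}{\|B\|_2^{1/2}},\qquad \sigma_0=\sigma\frac{\|B\|_2}{\|A\|_2}.$$ Let $F_1\in\mathbb{R}^{n\times r}$ and symmetric $E,F,G$ be backward/forward error matrices satisfying the relations and bounds (7)–(10) listed in the context. Suppose that $(A+E)-\sigma(B+F)$ is invertible. Let $\hat\theta_i$ and $\hat u_i$, $i=1,\dots,r$, be the eigenvalues and corresponding eigenvectors of $$\hat W=(C_b+F_1)^{T}\bigl(A+E-\sigma(B+F)\bigr)^{-1}(C_b+F_1),$$ with the $\hat\theta_i$ also in nondecreasing order. Assume that $(C_b+F_1)\hat u_i\ne0$ and define (exactly, without further numerical error) $$\hat v_i=\bigl(A+E-\sigma(B+F)\bigr)^{-1}(C_b+F_1)\hat u_i\neq 0.$$ Then $$\bigl\|\bigl(\theta_i(A+E)-(1+\sigma\theta_i)(B+F)\bigr)\hat v_i\bigr\|_2\le u\,(e_n+f_n)(1+|\sigma_0|)\,\eta^2\|X\|_2^2\,\bigl(|\theta_i|\,\|A+E\|_2+|1+\sigma\theta_i|\,\|B+F\|_2\bigr)\|\hat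 v_i\|_2+O(u^2).$$
   Context: Here $u$ is the unit roundoff, and $a_n,b_n,c_n,d_n,e_n,f_n,g_n$ are positive functions of $n$. Floating point model: $\mathrm{fl}(x\circ y)=(x\circ y)(1+\delta)$, $|\delta|\le u$. The matrix $\breve A=\mathrm{fl}(A-\sigma B)$ is computed element-wise, i.e. $\breve a_{ij}=\bigl(a_{ij}-\sigma b_{ij}(1+\delta_{ij})\bigr)(1+\delta'_{ij})$ with $|\delta_{ij}|,|\delta'_{ij}|\le u$, and $\breve A=\breve A^T$. The quantities $C_a\in\mathbb{R}^{n\times n}$, $D_a$ (diagonal, entries $\pm1$), $C_b\in\mathbb{R}^{n\times r}$ ($r\le n$), $X\in\mathbb{R}^{n\times r}$, $W,U\in\mathbb{R}^{r\times r}$, and diagonal $\Theta\in\mathbb{R}^{r\times r}$ are computed by a spectral transformation algorithm (factor $A-\sigma B=C_aD_aC_a^T$, $B=C_bC_b^T$, solve $C_aX=C_b$, form $W=X^TD_aX$, decompose $W=U\Theta U^T$), with errors satisfying, for some orthogonal $\tilde U\in\mathbb{R}^{r\times r}$: (1) $\|\breve A-C_aD_aC_a^T\|_2\le u a_n\|\breve A\|_2$, $\|C_a\|_2\le b_n\|\breve A\|_2^{1/2}$; (2) $\|B-C_bC_b^T\|_2\le u c_n\|B\|_2$; (3) $\|C_aX-C_b\|_2\le u d_n\|C_a\|_2\|X\|_2$; (4) $\|W-X^TD_aX\|_2\le u e_n\|X\|_2^2$, $W=W^T$; (5) $\|W-\tilde U\Theta\tilde U^T\|_2\le u f_n\|W\|_2$;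 (6) $\|\tilde U-U\|_2\le u g_n$. The error matrices $F_1$, $E$, $F$, $G$ ($E,F\in\mathbb{R}^{n\times n}$ and $G\in\mathbb{R}^{r\times r}$ symmetric) satisfy: (7) $(C_b+F_1)(C_b+F_1)^T=B+F$ and $(A+E)-\sigma(B+F)=A-\sigma B+\breve E=C_aD_aC_a^T$, with $\breve E$ symmetric and $\|\breve E\|_2\le nu\|\sigma B\|_2+u(n+a_n)\|A-\sigma B\|_2+O(u^2)$; (8) $(C_b+F_1)^T(A+E-\sigma(B+F))^{-1}(C_b+F_1)=\tilde U(\Theta+G)\tilde U^T$ with $\|G\|_2\le u(e_n+f_n)\|X\|_2^2+O(u^2)$; (9) $\|F_1\|_2\le u b_nd_n\eta\|X\|_2\|C_b\|_2+O(u^2)$ and $\|F\|_2\le u(c_n+2b_nd_n\eta\|X\|_2)\|B\|_2+O(u^2)$; (10) $\|E\|_2\le u\bigl(n(1+2|\sigma_0|)+(1+|\sigma_0|)a_n+|\sigma_0|c_n+2|\sigma_0|b_nd_n\eta\|X\|_2\bigr)\|A\|_2+O(u^2)$. Convention on $O(u^2)$ (first-order analysis as $u\to0$): an $O(u^2)$ term is bounded in absolute value by $Ku^2$ for all $0<u\le u_0$, where $K,u_0>0$ depend only on $n,A,B,\sigma$, the constants $a_n,\dots,g_n$ (and, in the conclusion, on the constants implicit in the hypotheses (7)–(10)), uniformly over all matrices satisfying the hypotheses. In the conclusion, which is homogeneous in $\hat v_i$, the $O(u^2)$ term is bounded by $Ku^2\|\hat v_i\|_2$. *)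

theory Defs
  imports "HOL-Analysis.Analysis"
begin

text \<open>The matrix 2-norm is the operator norm with respect to the Euclidean norms
  (\<open>norm\<close> on matrices is the Frobenius norm).\<close>

abbreviation norm2 :: "real^'m^'k \<Rightarrow> real"
  where "norm2 M \<equiv> onorm ((*v) M)"

definition symmetric_matrix :: "real^'k^'k \<Rightarrow> bool"
  where "symmetric_matrix M \<longleftrightarrow> transpose M = M"

definition positive_semidefinite :: "real^'k^'k \<Rightarrow> bool"
  where "positive_semidefinite M \<longleftrightarrow> symmetric_matrix M \<and> (\<forall>x. 0 \<le> x \<bullet> (M *v x))"

definition diagonal_matrix :: "('k \<Rightarrow> real) \<Rightarrow> real^'k^'k"
  where "diagonal_matrix d = (\<chi> i j. if i = j then d i else 0)"

text \<open>\<open>is_fl_shift u A \<sigma> B M\<close>: \<open>M\<close> is a possible outcome of the element-wise floating point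
  evaluation of \<open>A - \<sigma>B\<close> with unit roundoff \<open>u\<close>.\<close>

definition is_fl_shift :: "real \<Rightarrow> real^'k^'k \<Rightarrow> real \<Rightarrow> real^'k^'k \<Rightarrow> real^'k^'k \<Rightarrow> bool"
  where "is_fl_shift u A \<sigma> B M \<longleftrightarrow>
    (\<exists>\<delta> \<delta>'. \<forall>i j. \<bar>\<delta> i j\<bar> \<le> u \<and> \<bar>\<delta>' i j\<bar> \<le> u \<and>
       M $ i $ j = (A $ i $ j - \<sigma> * B $ i $ j * (1 + \<delta> i j)) * (1 + \<delta>' i j))"

text \<open>The family \<open>ev\<close> lists all eigenvalues of \<open>M\<close>, each repeated according to its (algebraic)
  multiplicity: \<open>det (x I - M)\<close> is the product of the \<open>x - ev i\<close>.\<close>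

definition eigenvalue_family :: "real^'k^'k \<Rightarrow> ('k \<Rightarrow> real) \<Rightarrow> bool"
  where "eigenvalue_family M ev \<longleftrightarrow> (\<forall>x. det (mat x - M) = (\<Prod>i\<in>UNIV. x - ev i))"

definition is_eigenvector :: "real^'k^'k \<Rightarrow> real \<Rightarrow> real^'k \<Rightarrow> bool"
  where "is_eigenvector M ev x \<longleftrightarrow> x \<noteq> 0 \<and> M *v x = ev *\<^sub>R x"

end

theory Submission
  imports Defs "HOL-Combinatorics.Permutations"
begin

text \<open>Write \<open>M = (A + E) - \<sigma>(B + F)\<close> and \<open>C = C\<^sub>b + F\<^sub>1\<close>.  Since \<open>C C\<^sup>T = B + F\<close>, an eigenvector
  of \<open>C\<^sup>T M\<^sup>-\<^sup>1 C\<close> to \<open>\<theta>\<^sub>h i\<close> gives \<open>(B + F) v = \<theta>\<^sub>h i M v\<close>, so the residual is exactly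
  \<open>(\<theta> i - \<theta>\<^sub>h i) M v\<close>.  Weyl's inequality bounds the first factor by \<open>\<parallel>G\<parallel>\<close>, and
  \<open>\<parallel>M\<parallel> \<approx> \<parallel>A - \<sigma>B\<parallel> = \<eta>\<^sup>2 \<parallel>B\<parallel>\<close>, where
  \<open>\<parallel>B\<parallel> \<le> (1 + \<bar>\<sigma>\<^sub>0\<bar>) (\<bar>\<theta>\<bar> \<parallel>A\<parallel> + \<bar>1 + \<sigma>\<theta>\<bar> \<parallel>B\<parallel>)\<close> for every \<open>\<theta>\<close>.  The remainders are uniformly
  \<open>O(u\<^sup>2)\<close> because \<open>\<parallel>X\<parallel>\<close> stays bounded: \<open>C\<^sub>a D\<^sub>a C\<^sub>a\<^sup>T = M\<close> is close to the invertible \<open>A - \<sigma>B\<close>,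
  which bounds \<open>C\<^sub>a\<^sup>-\<^sup>1\<close>.\<close>

subsection \<open>Eigenvalues of symmetric matrices\<close>

lemma symmetric_form_commute:
  assumes "symmetric_matrix M"
  shows "x \<bullet> (M *v y) = (M *v x) \<bullet> y"
  using assms by (metis dot_lmul_matrix symmetric_matrix_def transpose_matrix_vector)

text \<open>A maximizer \<open>x\<close> of the quadratic form over the unit sphere of
  \<open>T\<close> is an eigenvector: \<open>w = M x - c x\<close> lies in \<open>T\<close> and is
  orthogonal to \<open>x\<close>, and a nonzero \<open>w\<close> would be a direction of
  ascent.\<close>

lemma symmetric_eigenvector_on_invariant_subspace:
  fixes M :: "real^'k^'k"
  assumes M: "symmetric_matrix M" and T: "subspace T" and inv: "\<And>x. x \<in> T \<Longrightarrow> M *v x \<in> T"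
    and nz: "dim T \<noteq> 0"
  obtains x c where "x \<in> T" "norm x = 1" "M *v x = c *\<^sub>R x"
proof -
  let ?S = "T \<inter> sphere 0 1"
  obtain y where y: "y \<in> T" "y \<noteq> 0"
    using nz unfolding dim_eq_0 by auto
  have "(1 / norm y) *\<^sub>R y \<in> ?S"
    using y T by (simp add: subspace_scale)
  moreover have "compact ?S"
    using T closed_subspace by (metis closed_Int_compact compact_sphere)
  moreover have "continuous_on ?S (\<lambda>x. x \<bullet> (M *v x))"
    by (intro continuous_intros)
  ultimately obtain x where x: "x \<in> ?S" and max: "\<And>z. z \<in> ?S \<Longrightarrow> z \<bullet> (M *v z) \<le> x \<bullet> (M *v x)"
    using continuous_attains_sup[of ?S "\<lambda>x. x \<bullet> (M *v x)"] by blast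
  define c where "c = x \<bullet> (M *v x)"
  have nx: "norm x = 1" "x \<bullet> x = 1" "x \<in> T"
    using x by (auto simp: norm_eq_1)
  have bound: "z \<bullet> (M *v z) \<le> c * (z \<bullet> z)" if "z \<in> T" for z
  proof (cases "z = 0")
    case False
    then have "(1 / norm z) *\<^sub>R z \<in> ?S"
      using that T by (simp add: subspace_scale)
    then have "(1 / norm z) *\<^sub>R z \<bullet> (M *v ((1 / norm z) *\<^sub>R z)) \<le> c"
      unfolding c_def by (rule max)
    then have "z \<bullet> (M *v z) / (norm z)\<^sup>2 \<le> c"
      by (simp add: matrix_vector_mult_scaleR power2_eq_square)
    then show ?thesis
      using False by (simp add: pos_divide_le_eq dot_square_norm)
  qed simp
  define w where "w = M *v x - c *\<^sub>R x"
  have wT: "w \<in> T"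
    using T nx inv by (simp add: w_def subspace_diff subspace_scale)
  have wx: "w \<bullet> x = 0"
    by (simp add: w_def inner_diff_left nx) (simp add: c_def inner_commute)
  have Mxw: "x \<bullet> (M *v w) = w \<bullet> w" "w \<bullet> (M *v x) = w \<bullet> w"
    using wx symmetric_form_commute[OF M, of x w]
    by (simp_all add: w_def inner_diff_left inner_diff_right inner_commute)
  \<comment> \<open>Perturbing the maximizer \<open>x\<close> in the direction \<open>w\<close> increases the form to first order.\<close>
  have quad: "2 * t * (w \<bullet> w) \<le> t\<^sup>2 * (c * (w \<bullet> w) - w \<bullet> (M *v w))" for t
  proof -
    have "(x + t *\<^sub>R w) \<bullet> (M *v (x + t *\<^sub>R w)) = c + 2 * t * (w \<bullet> w) + t\<^sup>2 * (w \<bullet> (M *v w))"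
      by (simp add: matrix_vector_right_distrib matrix_vector_mult_scaleR inner_add_left
          inner_add_right Mxw c_def power2_eq_square algebra_simps)
    moreover have "(x + t *\<^sub>R w) \<bullet> (x + t *\<^sub>R w) = 1 + t\<^sup>2 * (w \<bullet> w)"
      using wx by (simp add: inner_add_left inner_add_right nx power2_eq_square inner_commute)
    moreover have "x + t *\<^sub>R w \<in> T"
      using T nx wT by (simp add: subspace_add subspace_scale)
    ultimately show ?thesis
      using bound[of "x + t *\<^sub>R w"] by (simp add: algebra_simps)
  qed
  have "w \<bullet> w = 0"
  proof (rule ccontr)
    assume "w \<bullet> w \<noteq> 0"
    then have pos: "w \<bullet> w > 0" by (simp add: less_le)
    \<comment> \<open>The absolute value plus 1 makes \<open>q\<close> a positive bound for the
      quadratic coefficient. With \<open>t = (w \<bullet> w) / q\<close> the right side of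
      \<open>quad\<close> is at most half of the left side, which forces
      \<open>w \<bullet> w\<close> to vanish.\<close>
    define q where "q = \<bar>c * (w \<bullet> w) - w \<bullet> (M *v w)\<bar> + 1"
    have q: "q > 0" "c * (w \<bullet> w) - w \<bullet> (M *v w) \<le> q" by (simp_all add: q_def)
    let ?t = "(w \<bullet> w) / q"
    have "2 * ?t * (w \<bullet> w) \<le> ?t\<^sup>2 * q"
      using quad[of ?t] mult_left_mono[OF q(2), of "?t\<^sup>2"] by simp
    also have "\<dots> = ?t * (w \<bullet> w)"
      using q by (simp add: power2_eq_square)
    finally have "?t * (w \<bullet> w) \<le> 0" by linarith
    then show False using pos q by (simp add: mult_le_0_iff divide_le_0_iff)
  qed
  then have "M *v x = c *\<^sub>R x"
    by (simp add: w_def)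
  with nx that show thesis by blast
qed

text \<open>Induction on the dimension: split off a unit eigenvector \<open>x\<close>. Its
  orthogonal complement in \<open>T\<close> is again invariant, since
  \<open>x \<bullet> M y = M x \<bullet> y = c (x \<bullet> y) = 0\<close>.\<close>

lemma symmetric_orthonormal_eigenbasis_subspace:
  fixes M :: "real^'k^'k"
  assumes M: "symmetric_matrix M"
  shows "\<lbrakk>subspace T; \<And>x. x \<in> T \<Longrightarrow> M *v x \<in> T\<rbrakk> \<Longrightarrow>
    \<exists>B\<subseteq>T. pairwise orthogonal B \<and> finite B \<and> card B = dim T \<and>
      (\<forall>b\<in>B. norm b = 1 \<and> (\<exists>c. M *v b = c *\<^sub>R b))"
proof (induction "dim T" arbitrary: T)
  case 0
  then show ?case by (intro exI[of _ "{}"]) auto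
next
  case (Suc m)
  obtain x c where x: "x \<in> T" "norm x = 1" "M *v x = c *\<^sub>R x"
    using symmetric_eigenvector_on_invariant_subspace[OF M] Suc.prems Suc.hyps
    by (metis nat.distinct(1))
  let ?N = "{y \<in> T. \<forall>z\<in>span {x}. orthogonal z y}"
  have N: "?N = {y \<in> T. x \<bullet> y = 0}"
    by (auto simp: span_singleton orthogonal_def)
  have "dim ?N + dim (span {x}) = dim T"
    using x Suc.prems(1) by (intro dim_subspace_orthogonal_to_vectors) (auto simp: span_minimal)
  moreover have "dim (span {x}) = 1"
    using x by (auto simp: dim_insert)
  ultimately have "m = dim ?N" using Suc.hyps by simp
  moreover have "subspace ?N"
    unfolding N using Suc.prems(1) by (auto simp: subspace_def inner_add_right)
  moreover have "M *v y \<in> ?N" if "y \<in> ?N" for y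
    using that Suc.prems(2) x symmetric_form_commute[OF M, of x y] unfolding N by auto
  ultimately obtain B where B: "B \<subseteq> ?N" "pairwise orthogonal B" "finite B" "card B = dim ?N"
      "\<forall>b\<in>B. norm b = 1 \<and> (\<exists>c. M *v b = c *\<^sub>R b)"
    using Suc.hyps(1)[of ?N] by blast
  have "x \<notin> B"
    using B(1) x unfolding N by (auto simp: norm_eq_1)
  moreover have "pairwise orthogonal (insert x B)"
    using B(1,2) unfolding N by (auto simp: pairwise_insert orthogonal_def inner_commute)
  ultimately show ?case
    using B x \<open>m = dim ?N\<close> Suc.hyps(2) unfolding N
    by (intro exI[of _ "insert x B"]) auto
qed

text \<open>Eigenpairs are indexed by the matrix index type, so that \<open>ev\<close> is comparable
  with an \<open>eigenvalue_family\<close> and can be sorted when that type is ordered.\<close>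

definition orthonormal_eigenbasis :: "real^'k^'k \<Rightarrow> ('k \<Rightarrow> real) \<Rightarrow> ('k \<Rightarrow> real^'k) \<Rightarrow> bool"
  where "orthonormal_eigenbasis M ev p \<longleftrightarrow>
    (\<forall>i j. p i \<bullet> p j = (if i = j then 1 else 0)) \<and> (\<forall>i. M *v p i = ev i *\<^sub>R p i)"

lemma symmetric_orthonormal_eigenbasis_exists:
  fixes M :: "real^'k^'k"
  assumes "symmetric_matrix M"
  obtains ev p where "orthonormal_eigenbasis M ev p"
proof -
  obtain B where B: "pairwise orthogonal B" "finite B" "card B = CARD('k)"
      "\<forall>b\<in>B. norm b = 1 \<and> (\<exists>c. M *v b = c *\<^sub>R b)"
    using symmetric_orthonormal_eigenbasis_subspace[OF assms, of UNIV] by auto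
  then obtain p :: "'k \<Rightarrow> real^'k" where p: "bij_betw p UNIV B"
    using finite_same_card_bij[of "UNIV :: 'k set" B] by auto
  have pB: "p i \<in> B" for i using p by (auto simp: bij_betw_def)
  have "\<exists>ev. \<forall>i. M *v p i = ev i *\<^sub>R p i"
    using B(4) pB by (intro choice allI) blast
  then obtain ev where "\<forall>i. M *v p i = ev i *\<^sub>R p i" ..
  moreover have "p i \<bullet> p j = 0" if "i \<noteq> j" for i j
    using that p pairwiseD[OF B(1) pB[of i] pB[of j]]
    by (auto simp: bij_betw_def inj_def orthogonal_def)
  moreover have "p i \<bullet> p i = 1" for i
    using B(4) pB by (simp add: norm_eq_1)
  ultimately have "orthonormal_eigenbasis M ev p"
    by (simp add: orthonormal_eigenbasis_def)
  with that show thesis .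
qed

section \<open>Eigenbases and characteristic polynomials\<close>

lemma matrix_diff_ldistrib:
  fixes A :: "'a::ring_1^'m^'n"
  shows "A ** (B - C) = A ** B - A ** C"
  by (simp add: matrix_matrix_mult_def vec_eq_iff right_diff_distrib sum_subtractf)

lemma matrix_diff_rdistrib:
  fixes A :: "'a::ring_1^'m^'n"
  shows "(A - B) ** C = A ** C - B ** C"
  by (simp add: matrix_matrix_mult_def vec_eq_iff left_diff_distrib sum_subtractf)

text \<open>The matrix \<open>P\<close> with columns \<open>p j\<close> diagonalizes:
  \<open>(x I - M) P = P diag (x - ev i)\<close>. Taking determinants and cancelling
  \<open>det P\<close> gives the factorization.\<close>

lemma eigenvalue_family_of_eigenbasis:
  fixes M :: "real^'k^'k"
  assumes "orthonormal_eigenbasis M ev p"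
  shows "eigenvalue_family M ev"
  unfolding eigenvalue_family_def
proof
  fix x
  define P :: "real^'k^'k" where "P = (\<chi> i j. p j $ i)"
  have col: "column j P = p j" for j
    by (simp add: P_def column_def vec_eq_iff)
  have "orthogonal_matrix P"
    using assms by (auto simp: orthogonal_matrix_orthonormal_columns col
        orthonormal_eigenbasis_def norm_eq_1 orthogonal_def)
  then have detP: "det P \<noteq> 0"
    using det_orthogonal_matrix by fastforce
  have "(M ** P) $ i $ j = (M *v p j) $ i" for i j
    by (simp add: matrix_matrix_mult_def matrix_vector_mult_def P_def)
  then have "(mat x - M) ** P = P ** diagonal_matrix (\<lambda>i. x - ev i)"
    using assms
    by (simp add: matrix_diff_rdistrib vec_eq_iff orthonormal_eigenbasis_def)
       (simp add: matrix_matrix_mult_def diagonal_matrix_def mat_def P_def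
        if_distrib[of "\<lambda>z. z * _"] if_distrib[of "\<lambda>z. _ * z"] algebra_simps cong: if_cong)
  then have "det (mat x - M) * det P = det P * det (diagonal_matrix (\<lambda>i. x - ev i) :: real^'k^'k)"
    by (metis det_mul)
  moreover have "det (diagonal_matrix (\<lambda>i. x - ev i) :: real^'k^'k) = (\<Prod>i\<in>UNIV. x - ev i)"
    by (subst det_diagonal) (auto simp: diagonal_matrix_def)
  ultimately show "det (mat x - M) = (\<Prod>i\<in>UNIV. x - ev i)"
    using detP by simp
qed

text \<open>The two products of linear factors agree at every real point, hence as polynomials,
  hence in their multisets of roots.\<close>

lemma eigenvalue_family_permutation:
  fixes M :: "real^'k^'k"
  assumes "eigenvalue_family M ev" "eigenvalue_family M ev'"
  obtains \<pi> where "bij \<pi>" "\<And>i. ev i = ev' (\<pi> i)"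
proof -
  have "(\<Prod>i\<in>UNIV. [:- ev i, 1:]) = (\<Prod>i\<in>UNIV. [:- ev' i, 1:])"
    using assms by (intro poly_ext) (simp add: poly_prod eigenvalue_family_def)
  then have "proots (\<Prod>i\<in>UNIV. [:- ev i, 1:]) = proots (\<Prod>i\<in>UNIV. [:- ev' i, 1:])"
    by simp
  then have "image_mset ev (mset_set UNIV) = image_mset ev' (mset_set UNIV)"
    by (subst (asm) (1 2) proots_prod) (auto simp: sum_unfold_sum_mset)
  then obtain \<pi> where "\<pi> permutes UNIV" "\<forall>i\<in>UNIV. ev i = ev' (\<pi> i)"
    using image_mset_eq_implies_permutes[of UNIV ev ev'] by auto
  with that[of \<pi>] show thesis by (simp add: permutes_bij)
qed

text \<open>Reindexing an arbitrary eigenbasis realizes the prescribed listing \<open>ev\<close>, in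
  particular a sorted one.\<close>

lemma symmetric_eigenbasis_of_eigenvalue_family:
  assumes "symmetric_matrix M" "eigenvalue_family M ev"
  obtains p where "orthonormal_eigenbasis M ev p"
proof -
  obtain ev' q where q: "orthonormal_eigenbasis M ev' q"
    using symmetric_orthonormal_eigenbasis_exists assms by blast
  then obtain \<pi> where \<pi>: "bij \<pi>" "\<And>i. ev i = ev' (\<pi> i)"
    using eigenvalue_family_permutation[OF assms(2) eigenvalue_family_of_eigenbasis] by metis
  then have "orthonormal_eigenbasis M ev (q \<circ> \<pi>)"
    using q by (auto simp: orthonormal_eigenbasis_def bij_def inj_def)
  with that show thesis .
qed

section \<open>Weyl's inequality for sorted eigenvalues\<close>

lemma orthonormal_eigenbasis_span_form:
  assumes "orthonormal_eigenbasis M ev p" and "x \<in> span (p ` J)"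
  obtains c where "x \<bullet> (M *v x) = (\<Sum>j\<in>J. ev j * (c j)\<^sup>2)" "x \<bullet> x = (\<Sum>j\<in>J. (c j)\<^sup>2)"
proof -
  have pp: "p i \<bullet> p j = (if i = j then 1 else 0)" and Mp: "M *v p i = ev i *\<^sub>R p i" for i j
    using assms by (auto simp: orthonormal_eigenbasis_def)
  have "inj p"
    using pp by (metis injI zero_neq_one)
  then obtain c where x: "x = (\<Sum>j\<in>J. c j *\<^sub>R p j)"
    using assms(2) by (auto simp: span_finite sum.reindex inj_on_subset)
  have orth: "(\<Sum>j\<in>J. c j *\<^sub>R p j) \<bullet> (\<Sum>j\<in>J. d j *\<^sub>R p j) = (\<Sum>j\<in>J. c j * d j)" for d
    by (simp add: inner_sum_left inner_sum_right pp if_distrib[of "\<lambda>z. _ * z"] mult.commute[of "d _"]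
        cong: if_cong)
  have "M *v x = (\<Sum>j\<in>J. (c j * ev j) *\<^sub>R p j)"
    by (simp add: x linear_sum[OF matrix_vector_mul_linear] matrix_vector_mult_scaleR Mp)
  then have "x \<bullet> (M *v x) = (\<Sum>j\<in>J. ev j * (c j)\<^sup>2)" "x \<bullet> x = (\<Sum>j\<in>J. (c j)\<^sup>2)"
    by (simp_all add: x orth power2_eq_square mult_ac)
  with that show thesis .
qed

lemma dim_span_orthonormal_eigenbasis:
  assumes "orthonormal_eigenbasis M ev p"
  shows "dim (span (p ` J)) = card J"
proof -
  have pp: "p i \<bullet> p j = (if i = j then 1 else 0)" for i j
    using assms by (auto simp: orthonormal_eigenbasis_def)
  have "inj p"
    using pp by (metis injI zero_neq_one)
  have "independent (p ` J)"
    using pp by (intro pairwise_orthogonal_independent)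
      (auto simp: pairwise_def orthogonal_def, metis inner_zero_left zero_neq_one)
  then show ?thesis
    using \<open>inj p\<close> by (simp add: dim_eq_card_independent card_image inj_on_subset)
qed

text \<open>On the span of the \<open>p j\<close> with \<open>j \<ge> i\<close> the Rayleigh
  quotient of \<open>S\<close> is at least \<open>\<alpha> i\<close>; on the span of the
  \<open>q j\<close> with \<open>j \<le> i\<close> that of \<open>T\<close> is at most
  \<open>\<beta> i\<close>. A common nonzero vector compares the two.\<close>

lemma eigenvalue_le_of_form_le:
  fixes S T :: "((real, 'r::{finite,linorder}) vec, 'r) vec"
  assumes S: "orthonormal_eigenbasis S \<alpha> p" "mono \<alpha>"
    and T: "orthonormal_eigenbasis T \<beta> q" "mono \<beta>"
    and le: "\<And>x. x \<bullet> (S *v x) \<le> x \<bullet> (T *v x) + g * (x \<bullet> x)"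
  shows "\<alpha> i \<le> \<beta> i + g"
proof -
  let ?P = "span (p ` {i..})" and ?Q = "span (q ` {..i})"
  \<comment> \<open>Courant--Fischer dimension count: the two spans have total dimension \<open>n + 1\<close>.\<close>
  have "card {i..} + card {..i} = card ({i..} \<union> {..i}) + card ({i..} \<inter> {..i})"
    by (rule card_Un_Int) auto
  moreover have "{i..} \<union> {..i} = UNIV" "{i..} \<inter> {..i} = {i}" by auto
  ultimately have "dim ?P + dim ?Q = CARD('r) + 1"
    using dim_span_orthonormal_eigenbasis[OF S(1), of "{i..}"]
      dim_span_orthonormal_eigenbasis[OF T(1), of "{..i}"] by simp
  moreover have "dim {x + y |x y. x \<in> ?P \<and> y \<in> ?Q} \<le> CARD('r)"
    using dim_subset_UNIV_cart by simp
  ultimately have "dim (?P \<inter> ?Q) \<noteq> 0"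
    using dim_sums_Int[of ?P ?Q] by (simp del: dim_eq_0)
  then obtain x where x: "x \<in> ?P" "x \<in> ?Q" "x \<noteq> 0"
    unfolding dim_eq_0 by auto
  obtain c where c: "x \<bullet> (S *v x) = (\<Sum>j\<in>{i..}. \<alpha> j * (c j)\<^sup>2)" "x \<bullet> x = (\<Sum>j\<in>{i..}. (c j)\<^sup>2)"
    using orthonormal_eigenbasis_span_form[OF S(1) x(1)] .
  obtain d where d: "x \<bullet> (T *v x) = (\<Sum>j\<in>{..i}. \<beta> j * (d j)\<^sup>2)" "x \<bullet> x = (\<Sum>j\<in>{..i}. (d j)\<^sup>2)"
    using orthonormal_eigenbasis_span_form[OF T(1) x(2)] .
  have "\<alpha> i * (x \<bullet> x) \<le> x \<bullet> (S *v x)"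
    unfolding c sum_distrib_left using S(2) by (intro sum_mono mult_right_mono) (auto simp: mono_def)
  also have "\<dots> \<le> x \<bullet> (T *v x) + g * (x \<bullet> x)" by (rule le)
  also have "x \<bullet> (T *v x) \<le> \<beta> i * (x \<bullet> x)"
    unfolding d sum_distrib_left using T(2) by (intro sum_mono mult_right_mono) (auto simp: mono_def)
  finally have "\<alpha> i * (x \<bullet> x) \<le> (\<beta> i + g) * (x \<bullet> x)" by (simp add: algebra_simps)
  then show ?thesis using x(3) by simp
qed

lemma norm_matrix_vector_le:
  fixes M :: "real^'a^'b"
  shows "norm (M *v x) \<le> norm2 M * norm x"
  by (simp add: onorm)

text \<open>By Cauchy-Schwarz the forms of \<open>S\<close> and \<open>S + G\<close> differ by at
  most \<open>norm2 G * (x \<bullet> x)\<close>, so the one-sided comparison applies in both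
  directions.\<close>

theorem weyl_eigenvalue_perturbation:
  fixes S G :: "((real, 'r::{finite,linorder}) vec, 'r) vec"
  assumes sym: "symmetric_matrix S" "symmetric_matrix G"
    and \<alpha>: "eigenvalue_family (S + G) \<alpha>" "mono \<alpha>" and \<beta>: "eigenvalue_family S \<beta>" "mono \<beta>"
  shows "\<bar>\<beta> i - \<alpha> i\<bar> \<le> norm2 G"
proof -
  have "symmetric_matrix (S + G)"
    using sym by (simp add: symmetric_matrix_def transpose_def vec_eq_iff)
  then obtain p q where p: "orthonormal_eigenbasis (S + G) \<alpha> p" and q: "orthonormal_eigenbasis S \<beta> q"
    using symmetric_eigenbasis_of_eigenvalue_family sym(1) \<alpha>(1) \<beta>(1) by metis
  have abs: "\<bar>x \<bullet> (G *v x)\<bar> \<le> norm2 G * (x \<bullet> x)" for x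
  proof -
    have "\<bar>x \<bullet> (G *v x)\<bar> \<le> norm x * norm (G *v x)"
      by (rule Cauchy_Schwarz_ineq2)
    also have "\<dots> \<le> norm x * (norm2 G * norm x)"
      by (intro mult_left_mono norm_matrix_vector_le) simp
    finally show ?thesis by (simp add: dot_square_norm power2_eq_square mult_ac)
  qed
  have form: "x \<bullet> ((S + G) *v x) = x \<bullet> (S *v x) + x \<bullet> (G *v x)" for x
    by (simp add: matrix_vector_mult_add_rdistrib inner_add_right)
  have "\<alpha> i \<le> \<beta> i + norm2 G"
  proof (rule eigenvalue_le_of_form_le[OF p \<alpha>(2) q \<beta>(2)])
    fix x show "x \<bullet> ((S + G) *v x) \<le> x \<bullet> (S *v x) + norm2 G * (x \<bullet> x)"
      using form[of x] abs[of x] by linarith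
  qed
  moreover have "\<beta> i \<le> \<alpha> i + norm2 G"
  proof (rule eigenvalue_le_of_form_le[OF q \<beta>(2) p \<alpha>(2)])
    fix x show "x \<bullet> (S *v x) \<le> x \<bullet> ((S + G) *v x) + norm2 G * (x \<bullet> x)"
      using form[of x] abs[of x] by linarith
  qed
  ultimately show ?thesis by linarith
qed

section \<open>Diagonal matrices and orthogonal similarity\<close>

lemma eigenvalue_family_diagonal: "eigenvalue_family (diagonal_matrix d) d"
  unfolding eigenvalue_family_def
proof
  fix x
  show "det (mat x - diagonal_matrix d) = (\<Prod>i\<in>UNIV. x - d i)"
    by (subst det_diagonal) (auto simp: diagonal_matrix_def mat_def)
qed

lemma symmetric_diagonal_matrix: "symmetric_matrix (diagonal_matrix d)"
  by (simp add: symmetric_matrix_def diagonal_matrix_def transpose_def vec_eq_iff)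

text \<open>Conjugation by \<open>V\<close> fixes \<open>x I\<close> and preserves determinants.
  This carries the eigenvalues of \<open>W\<^sub>h\<close> over to
  \<open>\<Theta> + G\<close>.\<close>

lemma eigenvalue_family_orthogonal_similarity:
  assumes "orthogonal_matrix V" and "eigenvalue_family (V ** N ** transpose V) ev"
  shows "eigenvalue_family N ev"
  unfolding eigenvalue_family_def
proof
  fix x
  have V: "V ** transpose V = mat 1"
    using assms(1) by (simp add: orthogonal_matrix_def)
  have x: "mat x = (x *\<^sub>R mat 1 :: real^'a^'a)"
    by (simp add: mat_def vec_eq_iff)
  have "V ** (mat x - N) ** transpose V = mat x - V ** N ** transpose V"
    by (simp add: matrix_diff_ldistrib matrix_diff_rdistrib x matrix_scalar_ac
        scalar_matrix_assoc[symmetric] V)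
  moreover have "det V * det (transpose V) = 1"
    by (metis V det_I det_mul)
  ultimately have "det (mat x - N) = det (mat x - V ** N ** transpose V)"
    by (metis det_mul mult.assoc mult.commute mult.right_neutral)
  then show "det (mat x - N) = (\<Prod>i\<in>UNIV. x - ev i)"
    using assms(2) by (simp add: eigenvalue_family_def)
qed

subsection \<open>Spectral norm bounds\<close>

lemma norm2_le:
  fixes M :: "real^'a^'b"
  assumes "\<And>x. norm (M *v x) \<le> b * norm x"
  shows "norm2 M \<le> b"
  using assms by (simp add: onorm_le mult.commute)

lemma norm2_nonneg: "0 \<le> norm2 (M :: real^'a^'b)"
  by (simp add: onorm_pos_le)

lemma norm2_pos: "0 < norm2 M" if "M \<noteq> 0" for M :: "real^'a^'b"
proof -
  have "\<exists>x. M *v x \<noteq> 0"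
    using that matrix_eq[of M 0] by auto
  then show ?thesis by (simp add: onorm_pos_lt)
qed

lemma norm2_add_le: "norm2 (M + N) \<le> norm2 M + norm2 N" for M :: "real^'a^'b"
proof -
  have "(*v) (M + N) = (\<lambda>x. M *v x + N *v x)"
    by (auto simp: matrix_vector_mult_add_rdistrib)
  then show ?thesis by (simp add: onorm_triangle)
qed

lemma norm2_minus: "norm2 (- M) = norm2 M" for M :: "real^'a^'b"
proof -
  have "(*v) (- M) = (\<lambda>x. - (M *v x))"
    using matrix_vector_mult_diff_rdistrib[of 0 M] by auto
  then show ?thesis by (simp add: onorm_neg)
qed

lemma norm2_diff_commute: "norm2 (M - N) = norm2 (N - M)" for M :: "real^'a^'b"
  using norm2_minus[of "M - N"] by simp

lemma norm2_triangle_sub: "norm2 M \<le> norm2 N + norm2 (M - N)" for M :: "real^'a^'b"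
  using norm2_add_le[of N "M - N"] by simp

text \<open>The second bound follows from the first: estimate
  \<open>x \<bullet> C (C\<^sup>T x)\<close> by Cauchy-Schwarz and cancel one factor
  \<open>norm (C\<^sup>T x)\<close>.\<close>

lemma norm_transpose_mult_le:
  fixes C :: "real^'a^'b"
  shows "(norm (transpose C *v x))\<^sup>2 = x \<bullet> (C ** transpose C *v x)"
    and "norm (transpose C *v x) \<le> norm2 C * norm x"
proof -
  show eq: "(norm (transpose C *v x))\<^sup>2 = x \<bullet> (C ** transpose C *v x)"
    by (metis dot_lmul_matrix matrix_vector_mul_assoc power2_norm_eq_inner transpose_matrix_vector)
  have "x \<bullet> (C ** transpose C *v x) \<le> norm x * norm (C *v (transpose C *v x))"
    by (metis matrix_vector_mul_assoc norm_cauchy_schwarz)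
  also have "\<dots> \<le> norm x * (norm2 C * norm (transpose C *v x))"
    by (intro mult_left_mono norm_matrix_vector_le) simp
  finally have "norm (transpose C *v x) * norm (transpose C *v x)
      \<le> (norm2 C * norm x) * norm (transpose C *v x)"
    using eq by (simp add: power2_eq_square mult_ac)
  then show "norm (transpose C *v x) \<le> norm2 C * norm x"
    by (cases "norm (transpose C *v x) = 0") (auto simp: norm2_nonneg)
qed

text \<open>The Gram form controls the transpose directly; \<open>C\<close> is then bounded as the
  transpose of its transpose. This turns closeness of \<open>C\<^sub>b C\<^sub>b\<^sup>T\<close> to
  \<open>B\<close> into a bound on \<open>C\<^sub>b\<close>.\<close>

lemma norm2_le_sqrt_gram:
  fixes C :: "real^'a^'b"
  shows "norm2 C \<le> sqrt (norm2 (C ** transpose C))"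
proof -
  have "norm (transpose C *v x) \<le> sqrt (norm2 (C ** transpose C)) * norm x" for x
  proof -
    have "(norm (transpose C *v x))\<^sup>2 \<le> norm x * norm (C ** transpose C *v x)"
      unfolding norm_transpose_mult_le(1) by (rule norm_cauchy_schwarz)
    also have "\<dots> \<le> norm x * (norm2 (C ** transpose C) * norm x)"
      by (intro mult_left_mono norm_matrix_vector_le) simp
    finally have "sqrt ((norm (transpose C *v x))\<^sup>2) \<le> sqrt (norm2 (C ** transpose C) * (norm x)\<^sup>2)"
      by (intro real_sqrt_le_mono) (simp add: power2_eq_square mult_ac)
    then show ?thesis by (simp add: real_sqrt_mult)
  qed
  then have "norm2 (transpose C) \<le> sqrt (norm2 (C ** transpose C))"
    by (rule norm2_le)
  moreover have "norm2 C \<le> norm2 (transpose C)"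
    by (rule norm2_le) (metis norm_transpose_mult_le(2) transpose_transpose)
  ultimately show ?thesis by linarith
qed

section \<open>Stability of inverses and of approximate solutions\<close>

lemma matrix_inv_inverse:
  fixes M :: "'a::semiring_1^'n^'m"
  assumes "invertible M"
  shows "M ** matrix_inv M = mat 1" and "matrix_inv M ** M = mat 1"
  using someI_ex[OF assms[unfolded invertible_def]] by (simp_all add: matrix_inv_def)

lemma matrix_inv_right_mult:
  fixes M :: "real^'k^'k"
  assumes "invertible M"
  shows "M *v (matrix_inv M *v x) = x"
  using assms by (simp add: matrix_vector_mul_assoc matrix_inv_inverse)

text \<open>Neumann-type argument: applying the inverse \<open>R\<close> of \<open>N\<close> to
  \<open>(N + E) y\<close> gives \<open>y + R E y\<close>, and the second term is at most half of
  \<open>norm y\<close>.\<close>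

lemma norm_le_inverse_perturbed:
  fixes N E :: "real^'k^'k"
  assumes "invertible N" and small: "norm2 (matrix_inv N) * norm2 E \<le> 1 / 2"
  shows "norm y \<le> 2 * norm2 (matrix_inv N) * norm ((N + E) *v y)"
proof -
  let ?R = "matrix_inv N"
  have "?R ** N = mat 1"
    using assms(1) by (rule matrix_inv_inverse)
  then have "?R *v ((N + E) *v y) = y + ?R *v (E *v y)"
    by (simp add: matrix_vector_mult_add_rdistrib matrix_vector_right_distrib
        matrix_vector_mul_assoc)
  then have "norm y \<le> norm (?R *v ((N + E) *v y)) + norm (?R *v (E *v y))"
    by (metis add_diff_cancel_right' norm_triangle_ineq4)
  also have "norm (?R *v (E *v y)) \<le> norm2 ?R * (norm2 E * norm y)"
    by (meson mult_left_mono norm2_nonneg norm_matrix_vector_le order_trans)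
  also have "\<dots> \<le> 1 / 2 * norm y"
    using small by (metis mult.assoc mult_right_mono norm_ge_zero)
  also have "norm (?R *v ((N + E) *v y)) \<le> norm2 ?R * norm ((N + E) *v y)"
    by (rule norm_matrix_vector_le)
  finally show ?thesis by linarith
qed

lemma norm_sign_diagonal_mult:
  assumes "\<And>i. s i = 1 \<or> s i = -1"
  shows "norm (diagonal_matrix s *v z) = norm z"
proof -
  have "norm ((diagonal_matrix s *v z) $ i) = norm (z $ i)" for i
    using assms[of i]
    by (auto simp: diagonal_matrix_def matrix_vector_mult_def if_distrib[of "\<lambda>a. a * _"] cong: if_cong)
  then show ?thesis by (simp add: norm_vec_def)
qed

text \<open>Since \<open>M = C D C\<^sup>T\<close> with \<open>D\<close> orthogonal, any \<open>z\<close> is \<open>D C\<^sup>T y\<close> for some \<open>y\<close> with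
  \<open>M y = C z\<close>; so a bound on \<open>M\<^sup>-\<^sup>1\<close> gives one on \<open>C\<^sup>-\<^sup>1\<close>.\<close>

lemma norm_le_indefinite_factor:
  fixes M C :: "real^'k^'k"
  assumes "invertible M" and M: "M = C ** diagonal_matrix s ** transpose C"
    and s: "\<And>i. s i = 1 \<or> s i = -1"
    and k: "\<And>y. norm y \<le> k * norm (M *v y)"
  shows "norm z \<le> norm2 C * k * norm (C *v z)"
proof -
  let ?D = "diagonal_matrix s"
  define y where "y = matrix_inv M *v (C *v z)"
  have My: "M *v y = C *v z"
    using assms(1) by (simp add: y_def matrix_inv_right_mult)
  \<comment> \<open>The factorization turns \<open>M M\<^sup>-\<^sup>1 = I\<close> into a right
    inverse of \<open>C\<close>. As \<open>C\<close> is square it is also a left inverse, so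
    \<open>C\<close> may be cancelled below.\<close>
  have "C ** (?D ** transpose C ** matrix_inv M) = mat 1"
    using matrix_inv_inverse(1)[OF assms(1)] unfolding M by (simp add: matrix_mul_assoc)
  then have C': "(?D ** transpose C ** matrix_inv M) ** C = mat 1"
    by (simp only: matrix_left_right_inverse)
  have "C *v (?D *v (transpose C *v y)) = C *v z"
    using My unfolding M by (simp only: matrix_vector_mul_assoc matrix_mul_assoc)
  then have "?D *v (transpose C *v y) = z"
    using C' by (metis matrix_vector_mul_assoc matrix_vector_mul_lid)
  moreover have "norm (?D *v (transpose C *v y)) = norm (transpose C *v y)"
    using s by (rule norm_sign_diagonal_mult)
  ultimately have "norm z = norm (transpose C *v y)"
    by (simp only:)
  also have "\<dots> \<le> norm2 C * norm y"
    by (rule norm_transpose_mult_le)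
  also have "\<dots> \<le> norm2 C * (k * norm (C *v z))"
    using k[of y] by (simp add: My mult_left_mono norm2_nonneg)
  finally show ?thesis by (simp add: mult.assoc)
qed

text \<open>The residual bound involves \<open>norm2 X\<close> itself;
  \<open>l * \<tau> \<le> 1 / 2\<close> lets that contribution be absorbed on the left, at the price
  of the factor 2.\<close>

lemma norm2_approximate_solution_le:
  fixes C :: "real^'a^'a" and X Y :: "real^'b^'a"
  assumes l: "\<And>z. norm z \<le> l * norm (C *v z)" "0 \<le> l"
    and res: "norm2 (C ** X - Y) \<le> \<tau> * norm2 X" and small: "l * \<tau> \<le> 1 / 2"
  shows "norm2 X \<le> 2 * l * norm2 Y"
proof -
  have "norm (X *v w) \<le> (l * (norm2 Y + \<tau> * norm2 X)) * norm w" for w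
  proof -
    have "norm (X *v w) \<le> l * norm ((C ** X) *v w)"
      using l(1)[of "X *v w"] by (simp add: matrix_vector_mul_assoc)
    also have "\<dots> \<le> l * (norm2 (C ** X) * norm w)"
      by (intro mult_left_mono norm_matrix_vector_le l)
    also have "\<dots> \<le> l * ((norm2 Y + \<tau> * norm2 X) * norm w)"
      using norm2_triangle_sub[of "C ** X" Y] res l(2)
      by (intro mult_left_mono mult_right_mono) auto
    finally show ?thesis by (simp add: mult.assoc)
  qed
  then have "norm2 X \<le> l * (norm2 Y + \<tau> * norm2 X)"
    by (rule norm2_le)
  also have "\<dots> = l * norm2 Y + (l * \<tau>) * norm2 X"
    by (simp add: algebra_simps)
  also have "\<dots> \<le> l * norm2 Y + 1 / 2 * norm2 X"
    by (intro add_left_mono mult_right_mono small norm2_nonneg)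
  finally show ?thesis by simp
qed

subsection \<open>The pencil residual\<close>

text \<open>An exact identity, applied with \<open>A + E\<close> and \<open>B + F\<close> for
  \<open>A\<close> and \<open>B\<close>. The pencil regroups as \<open>\<theta> M - B\<close>, and
  \<open>C\<^sup>T M\<^sup>-\<^sup>1 C x = \<mu> x\<close> yields
  \<open>B v = \<mu> M v\<close>.\<close>

lemma pencil_residual_eq:
  fixes A B M :: "real^'n^'n" and C :: "real^'r^'n"
  assumes M: "M = A - \<sigma> *\<^sub>R B" "invertible M" and B: "C ** transpose C = B"
    and x: "(transpose C ** matrix_inv M ** C) *v x = \<mu> *\<^sub>R x"
    and v: "v = matrix_inv M *v (C *v x)"
  shows "(\<theta> *\<^sub>R A - (1 + \<sigma> * \<theta>) *\<^sub>R B) *v v = (\<theta> - \<mu>) *\<^sub>R (M *v v)"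
proof -
  have Mv: "M *v v = C *v x"
    using M(2) by (simp add: v matrix_inv_right_mult)
  have "B *v v = C *v ((transpose C ** matrix_inv M ** C) *v x)"
    by (simp add: B[symmetric] v matrix_vector_mul_assoc matrix_mul_assoc)
  also have "\<dots> = \<mu> *\<^sub>R (M *v v)"
    by (simp add: x Mv matrix_vector_mult_scaleR)
  finally have Bv: "B *v v = \<mu> *\<^sub>R (M *v v)" .
  have "\<theta> *\<^sub>R A - (1 + \<sigma> * \<theta>) *\<^sub>R B = \<theta> *\<^sub>R M - B"
    by (simp add: M(1) algebra_simps)
  then show ?thesis
    by (simp add: matrix_vector_mult_diff_rdistrib Bv scaleR_matrix_vector_assoc[symmetric]
        scaleR_left_diff_distrib)
qed

text \<open>For \<open>\<alpha>' = \<alpha>\<close> and \<open>\<beta>' = \<beta>\<close> the sum is piecewise linear in \<open>\<theta>\<close>, hence minimal at \<open>\<theta> = 0\<close>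
  or at \<open>\<theta> = - 1 / \<sigma>\<close>, where it is \<open>\<beta>\<close> or \<open>\<beta> / \<bar>\<sigma>\<^sub>0\<bar>\<close>.  The relative form of the
  perturbation makes the bound uniform in \<open>\<theta>\<close>.\<close>

lemma pencil_weight_lower_bound:
  fixes \<alpha> \<beta> \<alpha>' \<beta>' c d u \<sigma> \<sigma>\<^sub>0 \<theta> :: real
  assumes pos: "\<alpha> > 0" "\<beta> > 0" "c \<ge> 0" "d \<ge> 0" "u \<ge> 0" "\<alpha>' \<ge> 0" "\<beta>' \<ge> 0"
    and \<alpha>': "\<alpha> \<le> \<alpha>' + c * u" and \<beta>': "\<beta> \<le> \<beta>' + d * u"
    and \<sigma>\<^sub>0: "\<sigma>\<^sub>0 = \<sigma> * (\<beta> / \<alpha>)"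
  shows "\<beta> \<le> (1 + \<bar>\<sigma>\<^sub>0\<bar>) * (\<bar>\<theta>\<bar> * \<alpha>' + \<bar>1 + \<sigma> * \<theta>\<bar> * \<beta>') + (c / \<alpha> + d / \<beta>) * u * \<beta>"
\<comment> \<open>Either \<open>t = 1 - (c / \<alpha> + d / \<beta>) u\<close> is nonnegative, and
  then \<open>t \<alpha> \<le> \<alpha>'\<close> and \<open>t \<beta> \<le> \<beta>'\<close>, or the
  remainder alone exceeds \<open>\<beta>\<close>.\<close>
proof (cases "(c / \<alpha> + d / \<beta>) * u \<le> 1")
  case True
  define t where "t = 1 - (c / \<alpha> + d / \<beta>) * u"
  have t: "t \<ge> 0" "t \<le> 1" using True pos by (auto simp: t_def)
  have "\<beta> = \<bar>1\<bar> * \<beta>" by simp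
  \<comment> \<open>Triangle inequality for
    \<open>1 = (1 + \<sigma> \<theta>) - \<sigma> \<theta>\<close>. Then \<open>\<bar>\<sigma>\<bar>
    \<beta> = \<bar>\<sigma>\<^sub>0\<bar> \<alpha>\<close> brings in \<open>\<alpha>\<close>, and
    nonnegative cross terms complete the product.\<close>
  also have "\<dots> \<le> (\<bar>\<sigma> * \<theta>\<bar> + \<bar>1 + \<sigma> * \<theta>\<bar>) * \<beta>"
    using pos by (intro mult_right_mono) auto
  also have "\<dots> = \<bar>\<sigma>\<^sub>0\<bar> * (\<bar>\<theta>\<bar> * \<alpha>) + \<bar>1 + \<sigma> * \<theta>\<bar> * \<beta>"
    using pos by (simp add: \<sigma>\<^sub>0 abs_mult field_simps)
  also have "\<dots> \<le> \<bar>\<sigma>\<^sub>0\<bar> * (\<bar>\<theta>\<bar> * \<alpha>) + \<bar>1 + \<sigma> * \<theta>\<bar> * \<beta> + \<bar>\<theta>\<bar> * \<alpha> + \<bar>\<sigma>\<^sub>0\<bar> * (\<bar>1 + \<sigma> * \<theta>\<bar> * \<beta>)"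
    using pos by simp
  also have "\<dots> = (1 + \<bar>\<sigma>\<^sub>0\<bar>) * (\<bar>\<theta>\<bar> * \<alpha> + \<bar>1 + \<sigma> * \<theta>\<bar> * \<beta>)"
    by (simp add: algebra_simps)
  finally have "t * \<beta> \<le> t * ((1 + \<bar>\<sigma>\<^sub>0\<bar>) * (\<bar>\<theta>\<bar> * \<alpha> + \<bar>1 + \<sigma> * \<theta>\<bar> * \<beta>))"
    using t(1) by (rule mult_left_mono)
  also have "\<dots> = (1 + \<bar>\<sigma>\<^sub>0\<bar>) * (\<bar>\<theta>\<bar> * (t * \<alpha>) + \<bar>1 + \<sigma> * \<theta>\<bar> * (t * \<beta>))"
    by (simp add: algebra_simps)
  also have "\<dots> \<le> (1 + \<bar>\<sigma>\<^sub>0\<bar>) * (\<bar>\<theta>\<bar> * \<alpha>' + \<bar>1 + \<sigma> * \<theta>\<bar> * \<beta>')"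
  proof -
    have "t * \<alpha> = \<alpha> - c * u - d / \<beta> * u * \<alpha>" "t * \<beta> = \<beta> - d * u - c / \<alpha> * u * \<beta>"
      using pos by (auto simp: t_def field_simps)
    moreover have "d / \<beta> * u * \<alpha> \<ge> 0" "c / \<alpha> * u * \<beta> \<ge> 0" using pos by auto
    ultimately have "t * \<alpha> \<le> \<alpha>'" "t * \<beta> \<le> \<beta>'" using \<alpha>' \<beta>' by linarith+
    then show ?thesis by (intro mult_left_mono add_mono) auto
  qed
  finally show ?thesis by (simp add: t_def algebra_simps)
next
  case False
  have "1 * \<beta> \<le> (c / \<alpha> + d / \<beta>) * u * \<beta>"
    using False pos by (intro mult_right_mono) auto
  moreover have "(1 + \<bar>\<sigma>\<^sub>0\<bar>) * (\<bar>\<theta>\<bar> * \<alpha>' + \<bar>1 + \<sigma> * \<theta>\<bar> * \<beta>') \<ge> 0"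
    using pos by (intro mult_nonneg_nonneg add_nonneg_nonneg) auto
  ultimately show ?thesis by linarith
qed

text \<open>Used with \<open>g\<close>, \<open>m\<close>, \<open>y\<close> as the norms of
  \<open>G\<close>, \<open>M\<close> and the squared norm of \<open>X\<close>. The linear term keeps
  \<open>y\<close>, while the remainder replaces it by its uniform bound \<open>z\<close>, so the
  constant does not depend on \<open>X\<close>.\<close>

lemma first_order_product_bound:
  fixes u h y z m N g c\<^sub>1 K \<kappa> \<beta> S \<eta> :: real
  assumes u: "0 \<le> u" "u \<le> 1" and nn: "0 \<le> h" "0 \<le> y" "0 \<le> c\<^sub>1" "0 \<le> K" "0 \<le> \<kappa>" "0 \<le> \<beta>" "0 \<le> m"
    and y: "y \<le> z" and g: "g \<le> u * h * y + K * u\<^sup>2" and m: "m \<le> N + c\<^sub>1 * u"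
    and N: "N = \<eta>\<^sup>2 * \<beta>" and \<beta>: "\<beta> \<le> S + \<kappa> * u * \<beta>"
  shows "g * m \<le> u * h * \<eta>\<^sup>2 * y * S + (h * z * (c\<^sub>1 + \<eta>\<^sup>2 * \<kappa> * \<beta>) + K * (N + c\<^sub>1)) * u\<^sup>2"
proof -
  have "g * m \<le> (u * h * y + K * u\<^sup>2) * m"
    using g nn by (intro mult_right_mono)
  also have "\<dots> \<le> (u * h * y) * (N + c\<^sub>1 * u) + (K * u\<^sup>2) * (N + c\<^sub>1)"
  proof -
    have "c\<^sub>1 * u \<le> c\<^sub>1" using u nn by (simp add: mult_left_le)
    then show ?thesis
      unfolding distrib_right using m nn u by (intro add_mono mult_left_mono) auto
  qed
  also have "(u * h * y) * (N + c\<^sub>1 * u) = (u * h * \<eta>\<^sup>2 * y) * \<beta> + h * y * c\<^sub>1 * u\<^sup>2"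
    by (simp add: N algebra_simps power2_eq_square)
  also have "\<dots> \<le> (u * h * \<eta>\<^sup>2 * y) * (S + \<kappa> * u * \<beta>) + h * y * c\<^sub>1 * u\<^sup>2"
    using \<beta> u nn by (intro add_mono mult_left_mono) auto
  also have "\<dots> = u * h * \<eta>\<^sup>2 * y * S + y * (h * (c\<^sub>1 + \<eta>\<^sup>2 * \<kappa> * \<beta>) * u\<^sup>2)"
    by (simp add: algebra_simps power2_eq_square)
  also have "\<dots> \<le> u * h * \<eta>\<^sup>2 * y * S + z * (h * (c\<^sub>1 + \<eta>\<^sup>2 * \<kappa> * \<beta>) * u\<^sup>2)"
    using y u nn by (intro add_left_mono mult_right_mono mult_nonneg_nonneg add_nonneg_nonneg) auto
  finally show ?thesis by (simp add: algebra_simps)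
qed

section \<open>Uniform constants and the first-order residual estimate\<close>

theorem theorem4p3:
  fixes A B :: "real^'n^'n"
    and \<sigma> \<eta> \<sigma>\<^sub>0 :: real
    and a\<^sub>n b\<^sub>n c\<^sub>n d\<^sub>n e\<^sub>n f\<^sub>n g\<^sub>n :: real
    and K\<^sub>h u\<^sub>h :: real
  assumes "A \<noteq> 0" and "B \<noteq> 0"
    and "symmetric_matrix A" and "positive_semidefinite B"
    and "invertible (A - \<sigma> *\<^sub>R B)"
    and "CARD('r::{finite,linorder}) \<le> CARD('n)"
    and "a\<^sub>n > 0" "b\<^sub>n > 0" "c\<^sub>n > 0" "d\<^sub>n > 0" "e\<^sub>n > 0" "f\<^sub>n > 0" "g\<^sub>n > 0"
    and "K\<^sub>h > 0" "u\<^sub>h > 0"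
    and "\<eta> = sqrt (norm2 (A - \<sigma> *\<^sub>R B)) / sqrt (norm2 B)"
    and "\<sigma>\<^sub>0 = \<sigma> * (norm2 B / norm2 A)"
  shows "\<exists>K>0. \<exists>u\<^sub>0>0. \<forall>u.
    \<forall>(A\<^sub>f :: real^'n^'n) (C\<^sub>a :: real^'n^'n) (D\<^sub>a :: real^'n^'n) (s :: 'n \<Rightarrow> real)
     (C\<^sub>b :: (real, 'r) vec^'n) (X :: (real, 'r) vec^'n) (W :: ((real, 'r) vec, 'r) vec) (U :: ((real, 'r) vec, 'r) vec)
     (V :: ((real, 'r) vec, 'r) vec) (\<Theta> :: ((real, 'r) vec, 'r) vec) (\<theta> :: 'r \<Rightarrow> real)
     (F\<^sub>1 :: (real, 'r) vec^'n) (E :: real^'n^'n) (F :: real^'n^'n) (E\<^sub>f :: real^'n^'n) (G :: ((real, 'r) vec, 'r) vec)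
     (M :: real^'n^'n) (W\<^sub>h :: ((real, 'r) vec, 'r) vec) (\<theta>\<^sub>h :: 'r \<Rightarrow> real)
     (u_hat :: 'r \<Rightarrow> (real, 'r) vec) (v_hat :: 'r \<Rightarrow> real^'n).
    0 < u \<and> u \<le> u\<^sub>0 \<and>
    is_fl_shift u A \<sigma> B A\<^sub>f \<and> symmetric_matrix A\<^sub>f \<and>
    D\<^sub>a = diagonal_matrix s \<and> (\<forall>i. s i = 1 \<or> s i = -1) \<and>
    \<Theta> = diagonal_matrix \<theta> \<and> mono \<theta> \<and> orthogonal_matrix V \<and>
    norm2 (A\<^sub>f - C\<^sub>a ** D\<^sub>a ** transpose C\<^sub>a) \<le> u * a\<^sub>n * norm2 A\<^sub>f \<and>
    norm2 C\<^sub>a \<le> b\<^sub>n * sqrt (norm2 A\<^sub>f) \<and>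
    norm2 (B - C\<^sub>b ** transpose C\<^sub>b) \<le> u * c\<^sub>n * norm2 B \<and>
    norm2 (C\<^sub>a ** X - C\<^sub>b) \<le> u * d\<^sub>n * norm2 C\<^sub>a * norm2 X \<and>
    norm2 (W - transpose X ** D\<^sub>a ** X) \<le> u * e\<^sub>n * (norm2 X)\<^sup>2 \<and> symmetric_matrix W \<and>
    norm2 (W - V ** \<Theta> ** transpose V) \<le> u * f\<^sub>n * norm2 W \<and>
    norm2 (V - U) \<le> u * g\<^sub>n \<and>
    symmetric_matrix E \<and> symmetric_matrix F \<and> symmetric_matrix G \<and>
    M = (A + E) - \<sigma> *\<^sub>R (B + F) \<and> invertible M \<and>
    W\<^sub>h = transpose (C\<^sub>b + F\<^sub>1) ** matrix_inv M ** (C\<^sub>b + F\<^sub>1) \<and>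
    (C\<^sub>b + F\<^sub>1) ** transpose (C\<^sub>b + F\<^sub>1) = B + F \<and>
    M = A - \<sigma> *\<^sub>R B + E\<^sub>f \<and> M = C\<^sub>a ** D\<^sub>a ** transpose C\<^sub>a \<and>
    symmetric_matrix E\<^sub>f \<and>
    (u \<le> u\<^sub>h \<longrightarrow> norm2 E\<^sub>f \<le> real CARD('n) * u * norm2 (\<sigma> *\<^sub>R B)
        + u * (real CARD('n) + a\<^sub>n) * norm2 (A - \<sigma> *\<^sub>R B) + K\<^sub>h * u\<^sup>2) \<and>
    W\<^sub>h = V ** (\<Theta> + G) ** transpose V \<and>
    (u \<le> u\<^sub>h \<longrightarrow> norm2 G \<le> u * (e\<^sub>n + f\<^sub>n) * (norm2 X)\<^sup>2 + K\<^sub>h * u\<^sup>2) \<and>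
    (u \<le> u\<^sub>h \<longrightarrow> norm2 F\<^sub>1 \<le> u * b\<^sub>n * d\<^sub>n * \<eta> * norm2 X * norm2 C\<^sub>b + K\<^sub>h * u\<^sup>2) \<and>
    (u \<le> u\<^sub>h \<longrightarrow> norm2 F \<le> u * (c\<^sub>n + 2 * b\<^sub>n * d\<^sub>n * \<eta> * norm2 X) * norm2 B + K\<^sub>h * u\<^sup>2) \<and>
    (u \<le> u\<^sub>h \<longrightarrow> norm2 E \<le> u * (real CARD('n) * (1 + 2 * \<bar>\<sigma>\<^sub>0\<bar>) + (1 + \<bar>\<sigma>\<^sub>0\<bar>) * a\<^sub>n
        + \<bar>\<sigma>\<^sub>0\<bar> * c\<^sub>n + 2 * \<bar>\<sigma>\<^sub>0\<bar> * b\<^sub>n * d\<^sub>n * \<eta> * norm2 X) * norm2 A + K\<^sub>h * u\<^sup>2) \<and>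
    eigenvalue_family W\<^sub>h \<theta>\<^sub>h \<and> mono \<theta>\<^sub>h \<and>
    (\<forall>i. is_eigenvector W\<^sub>h (\<theta>\<^sub>h i) (u_hat i)) \<and>
    (\<forall>i. v_hat i = matrix_inv M *v ((C\<^sub>b + F\<^sub>1) *v u_hat i))
    \<longrightarrow>
    (\<forall>i. (C\<^sub>b + F\<^sub>1) *v u_hat i \<noteq> 0 \<longrightarrow>
      v_hat i \<noteq> 0 \<and>
      norm ((\<theta> i *\<^sub>R (A + E) - (1 + \<sigma> * \<theta> i) *\<^sub>R (B + F)) *v v_hat i)
        \<le> u * (e\<^sub>n + f\<^sub>n) * (1 + \<bar>\<sigma>\<^sub>0\<bar>) * \<eta>\<^sup>2 * (norm2 X)\<^sup>2
            * (\<bar>\<theta> i\<bar> * norm2 (A + E) + \<bar>1 + \<sigma> * \<theta> i\<bar> * norm2 (B + F)) * norm (v_hat i)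
          + K * u\<^sup>2 * norm (v_hat i))"
proof -
  let ?N = "A - \<sigma> *\<^sub>R B"
  let ?n = "real CARD('n)"
  define \<alpha> \<beta> N k where "\<alpha> = norm2 A" and "\<beta> = norm2 B" and "N = norm2 ?N"
    and "k = norm2 (matrix_inv ?N)"
  have pos: "\<alpha> > 0" "\<beta> > 0" "N \<ge> 0" "k \<ge> 0"
    using assms(1,2) by (simp_all add: \<alpha>_def \<beta>_def N_def k_def norm2_pos norm2_nonneg)
  have \<eta>0: "\<eta> \<ge> 0"
    using pos by (simp add: assms(16) N_def[symmetric] \<beta>_def[symmetric])
  have N: "N = \<eta>\<^sup>2 * \<beta>"
    using pos by (simp add: assms(16) N_def[symmetric] \<beta>_def[symmetric] power_divide)
  \<comment> \<open>For small \<open>u\<close>: \<open>norm2 E\<^sub>f \<le> c\<^sub>1 u\<close>, \<open>norm2 F \<le> c\<^sub>2 u\<close>, \<open>norm2 E \<le> c\<^sub>3 u\<close>, \<open>norm2 C\<^sub>a \<le> p\<close>,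
    \<open>norm2 C\<^sub>b \<le> q\<close>, \<open>norm2 X \<le> x\<close>, and \<open>l\<close> bounds the inverse of \<open>C\<^sub>a\<close>.\<close>
  define c\<^sub>1 where "c\<^sub>1 = ?n * norm2 (\<sigma> *\<^sub>R B) + (?n + a\<^sub>n) * N + K\<^sub>h"
  define p q where "p = b\<^sub>n * sqrt (2 * (N + c\<^sub>1))" and "q = sqrt ((1 + c\<^sub>n) * \<beta>)"
  define l x where "l = p * (2 * k)" and "x = 2 * l * q"
  define c\<^sub>2 where "c\<^sub>2 = (c\<^sub>n + 2 * b\<^sub>n * d\<^sub>n * \<eta> * x) * \<beta> + K\<^sub>h"
  define c\<^sub>3 where "c\<^sub>3 = (?n * (1 + 2 * \<bar>\<sigma>\<^sub>0\<bar>) + (1 + \<bar>\<sigma>\<^sub>0\<bar>) * a\<^sub>n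
        + \<bar>\<sigma>\<^sub>0\<bar> * c\<^sub>n + 2 * \<bar>\<sigma>\<^sub>0\<bar> * b\<^sub>n * d\<^sub>n * \<eta> * x) * \<alpha> + K\<^sub>h"
  \<comment> \<open>\<open>\<kappa>\<close> is the relative perturbation rate in
    \<open>pencil_weight_lower_bound\<close>; \<open>K\<close> is the remainder constant of
    \<open>first_order_product_bound\<close> with \<open>h = e\<^sub>n + f\<^sub>n\<close> and
    \<open>z = x\<^sup>2\<close>.\<close>
  define \<kappa> where "\<kappa> = c\<^sub>3 / \<alpha> + c\<^sub>2 / \<beta>"
  define K where "K = (e\<^sub>n + f\<^sub>n) * x\<^sup>2 * (c\<^sub>1 + \<eta>\<^sup>2 * \<kappa> * \<beta>) + K\<^sub>h * (N + c\<^sub>1)"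
  \<comment> \<open>\<open>L\<close> dominates each coefficient whose product with \<open>u\<close>
    must be at most 1/2: 1 for \<open>u \<le> 1\<close>, \<open>k c\<^sub>1\<close> for the inverse
    of \<open>M\<close>, \<open>a\<^sub>n\<close> for \<open>A\<^sub>f\<close>, and
    \<open>l d\<^sub>n p\<close> for \<open>X\<close>.\<close>
  define L where "L = 1 + k * c\<^sub>1 + a\<^sub>n + l * (d\<^sub>n * p)"
  define u\<^sub>0 where "u\<^sub>0 = min u\<^sub>h (1 / (2 * L))"
  note params = \<open>a\<^sub>n > 0\<close> \<open>b\<^sub>n > 0\<close> \<open>c\<^sub>n > 0\<close> \<open>d\<^sub>n > 0\<close> \<open>e\<^sub>n > 0\<close> \<open>f\<^sub>n > 0\<close> \<open>K\<^sub>h > 0\<close> \<open>u\<^sub>h > 0\<close>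
  have c\<^sub>1: "c\<^sub>1 > 0"
    unfolding c\<^sub>1_def using params pos norm2_nonneg[of "\<sigma> *\<^sub>R B"]
    by (intro add_nonneg_pos add_nonneg_nonneg mult_nonneg_nonneg) auto
  have nn: "p \<ge> 0" "q \<ge> 0" "l \<ge> 0" "x \<ge> 0"
    using params pos c\<^sub>1 by (simp_all add: p_def q_def l_def x_def)
  have c\<^sub>2: "c\<^sub>2 > 0"
    unfolding c\<^sub>2_def using params pos nn \<eta>0
    by (intro add_nonneg_pos add_nonneg_nonneg mult_nonneg_nonneg) auto
  have c\<^sub>3: "c\<^sub>3 > 0"
    unfolding c\<^sub>3_def using params pos nn \<eta>0
    by (intro add_nonneg_pos add_nonneg_nonneg mult_nonneg_nonneg) auto
  have \<kappa>: "\<kappa> \<ge> 0"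
    using c\<^sub>2 c\<^sub>3 pos by (simp add: \<kappa>_def)
  have K: "K > 0"
    unfolding K_def using params pos nn \<kappa> c\<^sub>1
    by (intro add_nonneg_pos mult_nonneg_nonneg mult_pos_pos add_nonneg_nonneg) auto
  have L_terms: "k * c\<^sub>1 \<ge> 0" "l * (d\<^sub>n * p) \<ge> 0"
    using params pos nn c\<^sub>1 by simp_all
  then have L: "L \<ge> 1" "k * c\<^sub>1 \<le> L" "a\<^sub>n \<le> L" "l * (d\<^sub>n * p) \<le> L"
    using params by (auto simp: L_def)
  have u\<^sub>0: "u\<^sub>0 > 0"
    using L params by (simp add: u\<^sub>0_def)
  show ?thesis
  proof (rule exI[of _ K], rule conjI, rule K, rule exI[of _ u\<^sub>0], rule conjI, rule u\<^sub>0,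
      intro allI impI, elim conjE, goal_cases)
    case (1 u A\<^sub>f C\<^sub>a D\<^sub>a s C\<^sub>b X W U V \<Theta> \<theta> F\<^sub>1 E F E\<^sub>f G M W\<^sub>h \<theta>\<^sub>h u_hat v_hat i)
    note C\<^sub>bF\<^sub>1_nz = 1(1) and sign = 1(7) and \<Theta> = 1(8) and V = 1(10) and A\<^sub>f_bound = 1(11)
      and C\<^sub>a_bound = 1(12) and C\<^sub>b_bound = 1(13) and X_residual = 1(14) and M = 1(22,23,26)
      and W\<^sub>h = 1(24,30) and gram = 1(25) and E\<^sub>f_bound = 1(29) and G_bound = 1(31)
      and F_bound = 1(33) and E_bound = 1(34) and \<theta>\<^sub>h = 1(35,36) and eigenvector = 1(37) and v_hat = 1(38)
    have u: "0 \<le> u" "u \<le> u\<^sub>h" "L * u \<le> 1 / 2"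
      using 1(2,3) L by (auto simp: u\<^sub>0_def field_simps)
    have small: "t * u \<le> 1 / 2" if "t \<le> L" for t
      using u mult_right_mono[OF that u(1)] by linarith
    have u1: "u \<le> 1" "u\<^sup>2 \<le> u"
      using small[of 1] L u by (auto simp: power2_eq_square mult_left_le)
    have Ku: "K\<^sub>h * u\<^sup>2 \<le> K\<^sub>h * u"
      using u1 params by simp
    have factor: "M = C\<^sub>a ** diagonal_matrix s ** transpose C\<^sub>a"
      using 1(27) 1(6) by simp
    have "norm2 E\<^sub>f \<le> ?n * u * norm2 (\<sigma> *\<^sub>R B) + u * (?n + a\<^sub>n) * N + K\<^sub>h * u\<^sup>2"
      using E\<^sub>f_bound u(2) by (simp add: N_def)
    then have E\<^sub>f: "norm2 E\<^sub>f \<le> c\<^sub>1 * u"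
      using Ku by (simp add: c\<^sub>1_def algebra_simps)
    have normM: "norm2 M \<le> N + c\<^sub>1 * u"
      using norm2_add_le[of ?N E\<^sub>f] E\<^sub>f by (simp add: M(3) N_def)
    \<comment> \<open>The factorization error is relative to \<open>A\<^sub>f\<close>; absorbing it
      gives \<open>norm2 A\<^sub>f \<le> 2 norm2 M\<close>, the source of the 2 in
      \<open>p\<close>.\<close>
    have "norm2 A\<^sub>f \<le> norm2 M + norm2 (A\<^sub>f - M)"
      by (rule norm2_triangle_sub)
    also have "norm2 (A\<^sub>f - M) \<le> (a\<^sub>n * u) * norm2 A\<^sub>f"
      using A\<^sub>f_bound factor 1(6) by (simp add: mult.commute)
    also have "\<dots> \<le> 1 / 2 * norm2 A\<^sub>f"
      by (intro mult_right_mono small L norm2_nonneg)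
    finally have "norm2 A\<^sub>f \<le> 2 * norm2 M"
      by simp
    also have "\<dots> \<le> 2 * (N + c\<^sub>1)"
      using normM mult_left_mono[OF u1(1) less_imp_le[OF c\<^sub>1]] by simp
    finally have "b\<^sub>n * sqrt (norm2 A\<^sub>f) \<le> p"
      using params by (simp add: p_def)
    then have C\<^sub>a: "norm2 C\<^sub>a \<le> p"
      using C\<^sub>a_bound by linarith
    have "norm2 (C\<^sub>b ** transpose C\<^sub>b) \<le> \<beta> + norm2 (C\<^sub>b ** transpose C\<^sub>b - B)"
      unfolding \<beta>_def by (rule norm2_triangle_sub)
    also have "norm2 (C\<^sub>b ** transpose C\<^sub>b - B) \<le> u * c\<^sub>n * \<beta>"
      unfolding \<beta>_def by (subst norm2_diff_commute) (rule C\<^sub>b_bound)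
    also have "\<dots> \<le> c\<^sub>n * \<beta>"
      using u1 pos params by simp
    finally have C\<^sub>b: "norm2 C\<^sub>b \<le> q"
      using norm2_le_sqrt_gram[of C\<^sub>b]
      by (auto simp: q_def algebra_simps intro: order_trans real_sqrt_le_mono)
    have "k * norm2 E\<^sub>f \<le> (k * c\<^sub>1) * u"
      using mult_left_mono[OF E\<^sub>f, of k] pos by (simp add: mult.assoc)
    then have "norm y \<le> 2 * k * norm (M *v y)" for y
      using norm_le_inverse_perturbed[OF \<open>invertible ?N\<close>] small[OF L(2)]
      by (simp add: M(3) k_def)
    then have C\<^sub>a_inverse: "norm z \<le> l * norm (C\<^sub>a *v z)" for z
    proof -
      have "norm z \<le> norm2 C\<^sub>a * (2 * k) * norm (C\<^sub>a *v z)"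
        using M(2) factor sign \<open>\<And>y. norm y \<le> 2 * k * norm (M *v y)\<close>
        by (intro norm_le_indefinite_factor) auto
      also have "\<dots> \<le> l * norm (C\<^sub>a *v z)"
        unfolding l_def using C\<^sub>a pos by (intro mult_right_mono) auto
      finally show ?thesis .
    qed
    have "norm2 (C\<^sub>a ** X - C\<^sub>b) \<le> u * d\<^sub>n * norm2 C\<^sub>a * norm2 X"
      by (fact X_residual)
    also have "\<dots> \<le> u * d\<^sub>n * p * norm2 X"
      using C\<^sub>a u params by (intro mult_right_mono mult_left_mono norm2_nonneg) auto
    finally have "norm2 X \<le> 2 * l * norm2 C\<^sub>b"
      using C\<^sub>a_inverse nn small[OF L(4)]
      by (intro norm2_approximate_solution_le[where \<tau> = "u * d\<^sub>n * p"]) (auto simp: mult_ac)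
    also have "\<dots> \<le> x"
      unfolding x_def using C\<^sub>b nn by (intro mult_left_mono) auto
    finally have X: "norm2 X \<le> x" .
    \<comment> \<open>The bounds on \<open>F\<close> and \<open>E\<close> contain
      \<open>norm2 X\<close>; with \<open>norm2 X \<le> x\<close> they become uniformly linear in
      \<open>u\<close>.\<close>
    have "norm2 F \<le> u * (c\<^sub>n + 2 * b\<^sub>n * d\<^sub>n * \<eta> * norm2 X) * \<beta> + K\<^sub>h * u\<^sup>2"
      using F_bound u(2) by (simp add: \<beta>_def)
    also have "\<dots> \<le> u * (c\<^sub>n + 2 * b\<^sub>n * d\<^sub>n * \<eta> * x) * \<beta> + K\<^sub>h * u"
      using X u pos params \<eta>0 Ku by (intro add_mono mult_right_mono mult_left_mono) auto
    also have "\<dots> = c\<^sub>2 * u"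
      by (simp add: c\<^sub>2_def algebra_simps)
    finally have F: "\<beta> \<le> norm2 (B + F) + c\<^sub>2 * u"
      using norm2_triangle_sub[of B "B + F"] by (simp add: \<beta>_def norm2_minus)
    have "norm2 E \<le> u * (?n * (1 + 2 * \<bar>\<sigma>\<^sub>0\<bar>) + (1 + \<bar>\<sigma>\<^sub>0\<bar>) * a\<^sub>n + \<bar>\<sigma>\<^sub>0\<bar> * c\<^sub>n
        + 2 * \<bar>\<sigma>\<^sub>0\<bar> * b\<^sub>n * d\<^sub>n * \<eta> * norm2 X) * \<alpha> + K\<^sub>h * u\<^sup>2"
      using E_bound u(2) by (simp add: \<alpha>_def)
    also have "\<dots> \<le> u * (?n * (1 + 2 * \<bar>\<sigma>\<^sub>0\<bar>) + (1 + \<bar>\<sigma>\<^sub>0\<bar>) * a\<^sub>n + \<bar>\<sigma>\<^sub>0\<bar> * c\<^sub>n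
        + 2 * \<bar>\<sigma>\<^sub>0\<bar> * b\<^sub>n * d\<^sub>n * \<eta> * x) * \<alpha> + K\<^sub>h * u"
      using X u pos params \<eta>0 Ku
      by (intro add_mono mult_right_mono mult_left_mono order_refl) auto
    also have "\<dots> = c\<^sub>3 * u"
      by (simp add: c\<^sub>3_def algebra_simps)
    finally have E: "\<alpha> \<le> norm2 (A + E) + c\<^sub>3 * u"
      using norm2_triangle_sub[of A "A + E"] by (simp add: \<alpha>_def norm2_minus)
    define S where "S = (1 + \<bar>\<sigma>\<^sub>0\<bar>) * (\<bar>\<theta> i\<bar> * norm2 (A + E) + \<bar>1 + \<sigma> * \<theta> i\<bar> * norm2 (B + F))"
    have S: "\<beta> \<le> S + \<kappa> * u * \<beta>"
      unfolding S_def \<kappa>_def using pos c\<^sub>2 c\<^sub>3 u E F assms(17) norm2_nonneg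
      by (intro pencil_weight_lower_bound) (auto simp: \<alpha>_def \<beta>_def)
    have normG: "norm2 G \<le> u * (e\<^sub>n + f\<^sub>n) * (norm2 X)\<^sup>2 + K\<^sub>h * u\<^sup>2"
      using G_bound u(2) by simp
    have "eigenvalue_family (\<Theta> + G) \<theta>\<^sub>h"
      using eigenvalue_family_orthogonal_similarity[OF V] W\<^sub>h(2) \<theta>\<^sub>h(1) by simp
    then have weyl: "\<bar>\<theta> i - \<theta>\<^sub>h i\<bar> \<le> norm2 G"
      using \<Theta> 1(9,21) \<theta>\<^sub>h(2)
      by (intro weyl_eigenvalue_perturbation[of \<Theta>])
        (simp_all add: symmetric_diagonal_matrix eigenvalue_family_diagonal)
    let ?C = "C\<^sub>b + F\<^sub>1"
    let ?v = "v_hat i"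
    have v: "?v = matrix_inv M *v (?C *v u_hat i)"
      using v_hat by simp
    have eig: "(transpose ?C ** matrix_inv M ** ?C) *v u_hat i = \<theta>\<^sub>h i *\<^sub>R u_hat i"
      using eigenvector W\<^sub>h(1) by (simp add: is_eigenvector_def)
    have "M *v ?v = ?C *v u_hat i"
      using M(2) by (simp add: v matrix_inv_right_mult)
    then have "?v \<noteq> 0"
      using C\<^sub>bF\<^sub>1_nz by auto
    \<comment> \<open>The exact residual is \<open>(\<theta> i - \<theta>\<^sub>h i) M v\<close>;
      Weyl bounds the scalar by \<open>norm2 G\<close>.\<close>
    moreover have "norm ((\<theta> i *\<^sub>R (A + E) - (1 + \<sigma> * \<theta> i) *\<^sub>R (B + F)) *v ?v)
        \<le> (norm2 G * norm2 M) * norm ?v"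
      unfolding pencil_residual_eq[OF M(1,2) gram eig v]
      using weyl norm_matrix_vector_le[of M ?v]
      by (simp add: mult.assoc mult_mono norm2_nonneg)
    moreover have "norm2 G * norm2 M \<le> u * (e\<^sub>n + f\<^sub>n) * \<eta>\<^sup>2 * (norm2 X)\<^sup>2 * S + K * u\<^sup>2"
      unfolding K_def using u u1 params c\<^sub>1 \<kappa> pos X normG normM N S
      by (intro first_order_product_bound) (auto simp: norm2_nonneg power_mono)
    then have "(norm2 G * norm2 M) * norm ?v
        \<le> (u * (e\<^sub>n + f\<^sub>n) * \<eta>\<^sup>2 * (norm2 X)\<^sup>2 * S + K * u\<^sup>2) * norm ?v"
      by (rule mult_right_mono) simp
    ultimately show ?case
      by (simp add: S_def algebra_simps)
  qed
qed

end
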